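(* Let $0<\rho<1/2$, let $\eta_0$ be distributed according to the Bernoulli product measure $\mu^{(\rho)}$ of density $\rho$ on $\{0,1\}^{\mathbb Z}$, and let $\eta_\infty=\lim_{t\to\infty}\eta_t$ be the ($\mu^{(\rho)}$-a.s. existing) limit under the F-TASEP dynamics. Let $S_L=\sum_{i=1}^L\eta_\infty(i)$ and $V_L=\operatorname{Var}(S_L)=\mu^{(\rho)}(S_L^2)-(\rho L)^2$. Then $$\lim_{L\to\infty}\frac{V_L}{L}=\rho(1-\rho).$$
   Context: F-TASEP step $U$ on $\{0,1\}^{\mathbb Z}$ ($1$ = particle, $0$ = hole): simultaneously, every particle at a site $j$ with $\eta(j-1)=1$ and $\eta(j+1)=0$ moves to $j+1$; $\eta_t=U^t\eta_0$. For $\mu^{(\rho)}$-a.e. $\eta_0$ with $\rho<1/2$, each $\eta_t(i)$ is eventually constant in $t$, so $\eta_\infty$ is defined pointwise as a function of $\eta_0$. $\mu^{(\rho)}(F)$ denotes the expectation of $F$ under $\mu^{(\rho)}$. *)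

theory Defs
  imports "HOL-Probability.Probability"
begin

type_synonym config = "int \<Rightarrow> bool"

definition jumps :: "config \<Rightarrow> int \<Rightarrow> bool" where
  "jumps \<eta> j \<longleftrightarrow> \<eta> j \<and> \<eta> (j - 1) \<and> \<not> \<eta> (j + 1)"

text \<open>One parallel update: after it, a site is occupied iff its particle stayed
  or the particle of its left neighbour has jumped onto it.\<close>

definition ftasep_step :: "config \<Rightarrow> config" where
  "ftasep_step \<eta> = (\<lambda>i. (\<eta> i \<and> \<not> jumps \<eta> i) \<or> jumps \<eta> (i - 1))"

definition ftasep :: "nat \<Rightarrow> config \<Rightarrow> config" where
  "ftasep t \<eta> = (ftasep_step ^^ t) \<eta>"

text \<open>The limit is taken sitewise in the discrete topology of \<^typ>\<open>bool\<close>. At sites where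
  the limit does not exist the value is a fixed but unspecified Boolean.\<close>

definition ftasep_lim :: "config \<Rightarrow> config" where
  "ftasep_lim \<eta> = (\<lambda>i. lim (\<lambda>t. ftasep t \<eta> i))"

definition bernoulli_config :: "real \<Rightarrow> config measure" where
  "bernoulli_config \<rho> = (\<Pi>\<^sub>M i\<in>UNIV. measure_pmf (bernoulli_pmf \<rho>))"

definition limit_count :: "nat \<Rightarrow> config \<Rightarrow> real" where
  "limit_count L \<eta> = (\<Sum>i=1..int L. of_bool (ftasep_lim \<eta> i))"

definition limit_count_var :: "real \<Rightarrow> nat \<Rightarrow> real" where
  "limit_count_var \<rho> L = prob_space.variance (bernoulli_config \<rho>) (limit_count L)"

end

theory Submission
  imports Defs
begin

text \<open>Sitewise mass balance turns the limiting count into \<open>\<Sum>\<^sub>i \<eta>\<^sub>0(i) + J(0) - J(L)\<close>, where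
  \<open>J(a)\<close> is the total number of jumps out of site \<open>a\<close>. The initial count has variance
  \<open>\<rho> * (1 - \<rho>) * L\<close>, so it suffices that the second moment of \<open>J(a)\<close> is bounded uniformly in \<open>a\<close>;
  the means of \<open>J(0)\<close> and \<open>J(L)\<close> cancel by translation invariance.
  A pair of adjacent holes is never created and has not been crossed while it exists, so all
  particles that left \<open>a\<close> come from the interval between \<open>a\<close> and the nearest hole pair on its left,
  which at time \<open>t\<close> is still at least half full. Hence, up to rounding, \<open>J(a)\<close> is at most the
  maximal excess over half filling of the initial configuration on intervals ending in \<open>a\<close>. This is the supremum of a
  random walk with negative drift when \<open>\<rho> < 1/2\<close>, and it is controlled by the sum of the exponential
  weights \<open>r ^ (particles - holes)\<close> over these intervals, which has finite mean for suitable
  \<open>r > 1\<close>.\<close>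

section \<open>Currents and conservation of mass\<close>

definition current :: "config \<Rightarrow> nat \<Rightarrow> int \<Rightarrow> nat" where
  "current \<eta> t i = (\<Sum>s<t. of_bool (jumps (ftasep s \<eta>) i))"

lemma ftasep_0 [simp]: "ftasep 0 \<eta> = \<eta>"
  by (simp add: ftasep_def)

lemma ftasep_Suc: "ftasep (Suc t) \<eta> = ftasep_step (ftasep t \<eta>)"
  by (simp add: ftasep_def)

lemma current_Suc:
  "current \<eta> (Suc t) i = current \<eta> t i + of_bool (jumps (ftasep t \<eta>) i)"
  by (simp add: current_def)

lemma current_le: "current \<eta> t i \<le> t"
proof (induction t)
  case (Suc t)
  then show ?case by (simp add: current_Suc of_bool_def)
qed (simp add: current_def)

lemma mono_current: "mono (\<lambda>t. current \<eta> t i)"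
  by (intro mono_iff_le_Suc[THEN iffD2]) (simp add: current_Suc)

text \<open>An inflow needs an empty site and an outflow an occupied one, so the two never coincide
  at a site and each step changes its occupation by inflow minus outflow. Integers are used because
  the difference of the two currents can be negative.\<close>

lemma site_balance:
  "of_bool (ftasep t \<eta> i) = (of_bool (\<eta> i) + int (current \<eta> t (i - 1)) - int (current \<eta> t i) :: int)"
proof (induction t)
  case (Suc t)
  have "of_bool (ftasep_step \<zeta> i)
      = (of_bool (\<zeta> i) + of_bool (jumps \<zeta> (i - 1)) - of_bool (jumps \<zeta> i) :: int)" for \<zeta>
    by (auto simp: ftasep_step_def jumps_def)
  with Suc show ?case by (simp add: ftasep_Suc current_Suc)
qed (simp add: current_def)

section \<open>Occupation of intervals and hole pairs\<close>

definition occupation :: "config \<Rightarrow> int \<Rightarrow> nat \<Rightarrow> int" where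
  "occupation \<eta> a m = (\<Sum>k<m. of_bool (\<eta> (a - int k)))"

text \<open>Summing \<open>site_balance\<close> over the \<open>m\<close> sites ending in
  \<open>a\<close> telescopes. Since \<open>a - int m\<close> is the first site to the left of this
  interval, its current is the inflow.\<close>

lemma occupation_balance:
  "occupation (ftasep t \<eta>) a m
    = occupation \<eta> a m + int (current \<eta> t (a - int m)) - int (current \<eta> t a)"
proof (induction m)
  case (Suc m)
  then show ?case
    using site_balance[of t \<eta> "a - int m"] by (simp add: occupation_def algebra_simps)
qed (simp add: occupation_def)

text \<open>A jump over one of the bonds around a pair of neighbouring sites leaves one of the two sites
  occupied, and no later jump can empty both.\<close>

lemma hole_pair_backward:
  assumes "\<not> ftasep_step \<eta> i" "\<not> ftasep_step \<eta> (i + 1)"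
  shows "\<not> \<eta> i \<and> \<not> \<eta> (i + 1)"
  using assms by (auto simp: ftasep_step_def jumps_def)

text \<open>A hole pair present at time \<open>t\<close> was present at all earlier times, so its
  right site never held a particle that could have jumped.\<close>

lemma current_eq_0_if_hole_pair:
  assumes "\<not> ftasep t \<eta> i" "\<not> ftasep t \<eta> (i + 1)"
  shows "current \<eta> t (i + 1) = 0"
  using assms
proof (induction t)
  case (Suc t)
  have "\<not> ftasep t \<eta> i \<and> \<not> ftasep t \<eta> (i + 1)"
    using Suc.prems hole_pair_backward unfolding ftasep_Suc by blast
  with Suc.IH show ?case by (simp add: current_Suc jumps_def)
qed (simp add: current_def)

text \<open>Every hole other than one at the left end of the interval has a particle directly to its
  left, so holes outnumber particles by at most one.\<close>

lemma occupation_no_hole_pair: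
  assumes "\<And>k. Suc k < m \<Longrightarrow> \<eta> (a - int k) \<or> \<eta> (a - int (Suc k))"
  shows "int m \<le> 2 * occupation \<eta> a m + 1"
proof -
  \<comment> \<open>The induction has to remember the leftmost site: a particle there leaves one
    unit of slack, which a hole added next to it uses up. The premise \<open>m > 0\<close> keeps
    \<open>m - 1\<close> meaningful.\<close>
  have "m > 0 \<longrightarrow> int m + of_bool (\<eta> (a - int (m - 1))) \<le> 2 * occupation \<eta> a m + 1"
    using assms
  proof (induction m)
    case (Suc m)
    show ?case
    proof (cases m)
      case (Suc n)
      have "\<eta> (a - int n) \<or> \<eta> (a - int m)"
        using Suc.prems[of n] Suc by auto
      moreover have "int m + of_bool (\<eta> (a - int n)) \<le> 2 * occupation \<eta> a m + 1"
        using Suc.IH Suc.prems Suc by auto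
      ultimately show ?thesis
        by (cases "\<eta> (a - int n)"; cases "\<eta> (a - int m)") (auto simp: occupation_def)
    qed (simp add: occupation_def)
  qed simp
  then show ?thesis
    by (cases "m = 0"; cases "\<eta> (a - int (m - 1))") (auto simp: occupation_def)
qed

text \<open>The first hole pair to the left of \<open>a\<close> at time \<open>t\<close> blocks every inflow into the interval
  between it and \<open>a\<close>, and this interval is at least half full.\<close>

lemma current_le_excess_or_all_dense:
  "(\<exists>m. 2 * int (current \<eta> t a) + int m \<le> 2 * occupation \<eta> a m + 1)
    \<or> (\<forall>m. int m \<le> 2 * occupation \<eta> a m + 1 + 2 * int t)"
proof (cases "\<exists>m. \<not> ftasep t \<eta> (a - int m) \<and> \<not> ftasep t \<eta> (a - int (Suc m))")
  case True
  define m where "m = (LEAST m. \<not> ftasep t \<eta> (a - int m) \<and> \<not> ftasep t \<eta> (a - int (Suc m)))"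
  have m: "\<not> ftasep t \<eta> (a - int m) \<and> \<not> ftasep t \<eta> (a - int (Suc m))"
    unfolding m_def by (rule LeastI_ex) (rule True)
  have "ftasep t \<eta> (a - int k) \<or> ftasep t \<eta> (a - int (Suc k))" if "Suc k < m" for k
    using not_less_Least[of k "\<lambda>m. \<not> ftasep t \<eta> (a - int m) \<and> \<not> ftasep t \<eta> (a - int (Suc m))"] that
    unfolding m_def by linarith
  then have "int m \<le> 2 * occupation (ftasep t \<eta>) a m + 1"
    by (rule occupation_no_hole_pair)
  \<comment> \<open>The \<open>m\<close> sites ending in \<open>a\<close> stop just short of the
    pair, so the inflow is the current out of the right member \<open>a - int m\<close> of the
    pair.\<close>
  moreover have "current \<eta> t (a - int m) = 0"
    using current_eq_0_if_hole_pair[of t \<eta> "a - int (Suc m)"] m by simp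
  ultimately have "2 * int (current \<eta> t a) + int m \<le> 2 * occupation \<eta> a m + 1"
    by (simp add: occupation_balance)
  then show ?thesis by blast
next
  case False
  \<comment> \<open>With no hole pair to the left of \<open>a\<close>, every interval ending in
    \<open>a\<close> is at least half full up to rounding at time \<open>t\<close>. At most
    \<open>t\<close> particles have entered it, so the initial configuration was nearly as dense at
    every length.\<close>
  have "int m \<le> 2 * occupation \<eta> a m + 1 + 2 * int t" for m
  proof -
    have "int m \<le> 2 * occupation (ftasep t \<eta>) a m + 1"
      using False by (intro occupation_no_hole_pair) blast
    also have "occupation (ftasep t \<eta>) a m \<le> occupation \<eta> a m + int t"
      using current_le[of \<eta> t "a - int m"] by (simp add: occupation_balance)
    finally show ?thesis by simp
  qed
  then show ?thesis by blast
qed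

section \<open>Translations and existence of the limit\<close>

lemma ftasep_shift: "ftasep t (\<lambda>i. \<eta> (i + c)) = (\<lambda>i. ftasep t \<eta> (i + c))"
proof (induction t)
  case (Suc t)
  have "ftasep_step (\<lambda>i. \<zeta> (i + c)) = (\<lambda>i. ftasep_step \<zeta> (i + c))" for \<zeta>
    by (simp add: ftasep_step_def jumps_def fun_eq_iff algebra_simps)
  with Suc show ?case by (simp add: ftasep_Suc)
qed simp

lemma current_shift: "current (\<lambda>i. \<eta> (i + c)) t a = current \<eta> t (a + c)"
  by (simp add: current_def ftasep_shift jumps_def algebra_simps)

text \<open>A bounded nondecreasing sequence of naturals is eventually constant. Once the currents
  into and out of a site have both stopped growing, \<open>site_balance\<close> freezes its
  occupation.\<close>

lemma ftasep_convergent_if_current_bounded: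
  assumes "\<And>i. bdd_above (range (\<lambda>t. current \<eta> t i))"
  shows "(\<lambda>t. ftasep t \<eta> i) \<longlonglongrightarrow> ftasep_lim \<eta> i"
proof -
  define K where "K j = Max (range (\<lambda>t. current \<eta> t j))" for j
  have fin: "finite (range (\<lambda>t. current \<eta> t j))" for j
    using assms[of j] by (simp add: bdd_above_nat)
  have "\<forall>\<^sub>F t in sequentially. current \<eta> t j = K j" for j
  proof -
    have "K j \<in> range (\<lambda>t. current \<eta> t j)"
      unfolding K_def using fin by (rule Max_in) blast
    then obtain T where T: "K j = current \<eta> T j" by blast
    have "current \<eta> t j = K j" if "t \<ge> T" for t
    proof (rule antisym)
      show "current \<eta> t j \<le> K j" unfolding K_def using fin by (rule Max_ge) blast
      show "K j \<le> current \<eta> t j" using monoD[OF mono_current that] T by simp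
    qed
    then show ?thesis by (auto simp: eventually_sequentially)
  qed
  from this[of i] this[of "i - 1"]
  have "\<forall>\<^sub>F t in sequentially. ftasep t \<eta> i
      = (of_bool (\<eta> i) + int (K (i - 1)) - int (K i) = 1)"
  proof eventually_elim
    case (elim t)
    show ?case using site_balance[of t \<eta> i] elim by auto
  qed
  then have "convergent (\<lambda>t. ftasep t \<eta> i)"
    by (auto simp: convergent_def tendsto_discrete)
  then show ?thesis
    by (simp add: ftasep_lim_def convergent_LIMSEQ_iff)
qed

section \<open>Exponential weights dominating the current\<close>

definition excess_weight :: "real \<Rightarrow> config \<Rightarrow> int \<Rightarrow> ennreal" where
  "excess_weight r \<eta> a = (\<Sum>m. ennreal (\<Prod>k<m. if \<eta> (a - int k) then r else inverse r))"

text \<open>Links the product over sites, to which independence applies, with a power of particles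
  minus holes, the quantity in the bound on the current.\<close>

lemma prod_weight_eq_powi:
  fixes r :: real
  assumes "r > 0"
  shows "(\<Prod>k<m. if \<eta> (a - int k) then r else inverse r) = r powi (2 * occupation \<eta> a m - int m)"
proof (induction m)
  case (Suc m)
  define e where "e = (if \<eta> (a - int m) then 1 else - 1 :: int)"
  have *: "2 * occupation \<eta> a (Suc m) - int (Suc m) = (2 * occupation \<eta> a m - int m) + e"
    by (simp add: occupation_def e_def)
  have "r powi (2 * occupation \<eta> a (Suc m) - int (Suc m))
      = r powi (2 * occupation \<eta> a m - int m) * r powi e"
    unfolding * using assms by (intro power_int_add) simp
  then show ?case
    using Suc by (simp add: e_def power_int_minus)
qed (simp add: occupation_def)

text \<open>In the first case of \<open>current_le_excess_or_all_dense\<close> a single term of the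
  sum suffices, the rounding term \<open>1\<close> costing the factor \<open>r\<close>. In the
  second case the terms stay above a positive constant, so the weight is infinite and the bound is
  trivial.\<close>

lemma powi_current_le_excess_weight:
  fixes r :: real
  assumes "r > 1"
  shows "ennreal (r powi (2 * int (current \<eta> t a))) \<le> ennreal r * excess_weight r \<eta> a"
proof -
  define f where "f m = (\<Prod>k<m. if \<eta> (a - int k) then r else inverse r)" for m
  have f_eq: "f m = r powi (2 * occupation \<eta> a m - int m)" for m
    unfolding f_def using assms by (intro prod_weight_eq_powi) simp
  have f_pos: "0 < f m" for m
    unfolding f_eq using assms by simp
  have W: "excess_weight r \<eta> a = (\<Sum>m. ennreal (f m))"
    by (simp add: excess_weight_def f_def)
  from current_le_excess_or_all_dense[of \<eta> t a] show ?thesis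
  proof
    assume "\<exists>m. 2 * int (current \<eta> t a) + int m \<le> 2 * occupation \<eta> a m + 1"
    then obtain m where "2 * int (current \<eta> t a) + int m \<le> 2 * occupation \<eta> a m + 1" ..
    then have "r powi (2 * int (current \<eta> t a)) \<le> r powi (1 + (2 * occupation \<eta> a m - int m))"
      using assms by (intro power_int_increasing) auto
    also have "\<dots> = r * f m"
      using assms by (simp add: power_int_add f_eq)
    finally have "ennreal (r powi (2 * int (current \<eta> t a))) \<le> ennreal r * ennreal (f m)"
      using assms f_pos[of m] by (simp flip: ennreal_mult)
    also have "ennreal (f m) \<le> (\<Sum>m. ennreal (f m))"
      using sum_le_suminf[of "\<lambda>m. ennreal (f m)" "{m}"] by simp
    finally show ?thesis
      by (simp add: W mult_left_mono)
  next
    assume dense: "\<forall>m. int m \<le> 2 * occupation \<eta> a m + 1 + 2 * int t"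
    have lower: "r powi (- 1 - 2 * int t) \<le> f m" for m
    proof -
      have "- 1 - 2 * int t \<le> 2 * occupation \<eta> a m - int m"
        using dense[rule_format, of m] by simp
      then show ?thesis
        unfolding f_eq using assms by (intro power_int_increasing) auto
    qed
    have "(\<Sum>m. ennreal (f m)) = \<top>"
    proof (rule ccontr)
      assume "(\<Sum>m. ennreal (f m)) \<noteq> \<top>"
      then have "summable f"
        using f_pos by (intro summable_suminf_not_top) (auto intro: less_imp_le)
      then have "f \<longlonglongrightarrow> 0" by (rule summable_LIMSEQ_zero)
      then have "r powi (- 1 - 2 * int t) \<le> 0"
        using lower by (intro LIMSEQ_le_const) auto
      moreover have "0 < r powi (- 1 - 2 * int t)" using assms by simp
      ultimately show False by simp
    qed
    then show ?thesis
      using assms by (simp add: W ennreal_mult_top)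
  qed
qed

text \<open>Only second moments enter the variance. Bernoulli's inequality gives
  \<open>J * (r - 1) \<le> r ^ J\<close>, and squaring it turns the exponential bound into a
  quadratic one.\<close>

lemma current_square_le_excess_weight:
  fixes r :: real
  assumes "r > 1"
  shows "ennreal ((real (current \<eta> t a))\<^sup>2) \<le> ennreal (r / (r - 1)\<^sup>2) * excess_weight r \<eta> a"
proof -
  define J where "J = current \<eta> t a"
  have "1 + real J * (r - 1) \<le> (1 + (r - 1)) ^ J"
    using assms by (intro Bernoulli_inequality) simp
  then have "real J * (r - 1) \<le> r ^ J" by simp
  then have "(real J * (r - 1))\<^sup>2 \<le> (r ^ J)\<^sup>2"
    using assms by (intro power_mono) auto
  also have "(r ^ J)\<^sup>2 = r powi (2 * int J)"
    using power_int_of_nat[of r "J * 2"] by (simp add: mult.commute flip: power_mult)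
  finally have "(real J)\<^sup>2 \<le> (1 / (r - 1)\<^sup>2) * r powi (2 * int J)"
    using assms unfolding power_mult_distrib by (simp add: pos_le_divide_eq)
  then have "ennreal ((real J)\<^sup>2) \<le> ennreal ((1 / (r - 1)\<^sup>2) * r powi (2 * int J))"
    by (rule ennreal_leI)
  also have "\<dots> = ennreal (1 / (r - 1)\<^sup>2) * ennreal (r powi (2 * int J))"
    using assms by (intro ennreal_mult) auto
  also have "\<dots> \<le> ennreal (1 / (r - 1)\<^sup>2) * (ennreal r * excess_weight r \<eta> a)"
    unfolding J_def using powi_current_le_excess_weight[OF assms] by (intro mult_left_mono) auto
  also have "\<dots> = ennreal (1 / (r - 1)\<^sup>2 * r) * excess_weight r \<eta> a"
    using assms ennreal_mult[of "1 / (r - 1)\<^sup>2" r] by (simp add: mult.assoc)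
  finally show ?thesis by (simp add: J_def)
qed

section \<open>Measurability of the dynamics and of the limit\<close>

lemma lim_bool_eq:
  fixes X :: "nat \<Rightarrow> bool"
  shows "lim X \<longleftrightarrow> (if \<forall>\<^sub>F t in sequentially. X t then True
    else if \<forall>\<^sub>F t in sequentially. \<not> X t then False else (THE L. False))"
proof -
  have iff: "X \<longlonglongrightarrow> L \<longleftrightarrow> (\<forall>\<^sub>F t in sequentially. X t = L)" for L
    by (rule tendsto_discrete)
  consider "\<forall>\<^sub>F t in sequentially. X t" | "\<forall>\<^sub>F t in sequentially. \<not> X t"
    | "\<not> (\<forall>\<^sub>F t in sequentially. X t)" "\<not> (\<forall>\<^sub>F t in sequentially. \<not> X t)" by blast
  then show ?thesis
  proof cases
    case 1
    then have "lim X = True" by (intro limI) (simp add: iff)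
    with 1 show ?thesis by simp
  next
    case 2
    then have "lim X = False" by (intro limI) (simp add: iff)
    moreover have "\<not> (\<forall>\<^sub>F t in sequentially. X t)"
      using 2 eventually_conj[of X sequentially "\<lambda>t. \<not> X t"] by auto
    ultimately show ?thesis using 2 by simp
  next
    \<comment> \<open>Here \<open>lim\<close> describes an object that does not exist, so its value
      is the constant \<open>THE L. False\<close>, the same for all such sequences.\<close>
    case 3
    then have "\<not> X \<longlonglongrightarrow> L" for L by (cases L) (auto simp: iff)
    with 3 show ?thesis by (simp add: lim_def)
  qed
qed

lemma space_bernoulli_config [simp]: "space (bernoulli_config \<rho>) = UNIV"
  by (simp add: bernoulli_config_def space_PiM)

lemma measurable_bernoulli_config_component [measurable]:
  "(\<lambda>\<eta>. \<eta> i) \<in> bernoulli_config \<rho> \<rightarrow>\<^sub>M count_space UNIV"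
proof -
  have "(\<lambda>\<eta>. \<eta> i) \<in> bernoulli_config \<rho> \<rightarrow>\<^sub>M measure_pmf (bernoulli_pmf \<rho>)"
    unfolding bernoulli_config_def by measurable
  then show ?thesis
    by (simp cong: measurable_cong_sets)
qed

lemma measurable_bernoulli_config_component_pmf:
  "(\<lambda>\<eta>. \<eta> i) \<in> bernoulli_config \<rho> \<rightarrow>\<^sub>M measure_pmf p"
  using measurable_bernoulli_config_component[of i \<rho>] by (simp cong: measurable_cong_sets)

lemma measurable_ftasep [measurable]: "Measurable.pred (bernoulli_config \<rho>) (\<lambda>\<eta>. ftasep t \<eta> i)"
proof (induction t arbitrary: i)
  case (Suc t)
  note Suc [measurable]
  show ?case unfolding ftasep_Suc ftasep_step_def jumps_def by measurable
qed simp

lemma measurable_jumps_ftasep [measurable]: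
  "Measurable.pred (bernoulli_config \<rho>) (\<lambda>\<eta>. jumps (ftasep t \<eta>) i)"
  unfolding jumps_def by measurable

lemma measurable_current [measurable]:
  "(\<lambda>\<eta>. real (current \<eta> t i)) \<in> borel_measurable (bernoulli_config \<rho>)"
  unfolding current_def of_nat_sum of_nat_of_bool unfolding of_bool_def by measurable

text \<open>Rewriting with \<open>lim_bool_eq\<close> replaces the description operator in
  \<open>lim\<close> by countable quantifiers over time and a constant default.\<close>

lemma measurable_ftasep_lim [measurable]:
  "Measurable.pred (bernoulli_config \<rho>) (\<lambda>\<eta>. ftasep_lim \<eta> i)"
  unfolding ftasep_lim_def lim_bool_eq eventually_sequentially by measurable

lemma measurable_limit_count [measurable]:
  "limit_count L \<in> borel_measurable (bernoulli_config \<rho>)"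
  unfolding limit_count_def [abs_def] of_bool_def by measurable

lemma measurable_excess_weight [measurable]:
  "(\<lambda>\<eta>. excess_weight r \<eta> a) \<in> borel_measurable (bernoulli_config \<rho>)"
  unfolding excess_weight_def by measurable

lemma limit_count_bounds: "0 \<le> limit_count L \<eta>" "limit_count L \<eta> \<le> real L"
proof -
  show "0 \<le> limit_count L \<eta>" unfolding limit_count_def by (intro sum_nonneg) simp
  have "limit_count L \<eta> \<le> (\<Sum>i=1..int L. 1)"
    unfolding limit_count_def by (intro sum_mono) simp
  then show "limit_count L \<eta> \<le> real L" by simp
qed

section \<open>Independence, shifts and the mean weight under the Bernoulli measure\<close>

lemma prob_space_bernoulli_config: "prob_space (bernoulli_config \<rho>)"
  unfolding bernoulli_config_def by (intro prob_space_PiM prob_space_measure_pmf)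

lemma distr_bernoulli_config_component:
  "distr (bernoulli_config \<rho>) (measure_pmf (bernoulli_pmf \<rho>)) (\<lambda>\<eta>. \<eta> i) = measure_pmf (bernoulli_pmf \<rho>)"
  unfolding bernoulli_config_def
  by (intro distr_PiM_component prob_space_measure_pmf) simp

text \<open>The joint law of all coordinates is the law of the identity map, hence the product
  measure itself, which characterises independence.\<close>

lemma indep_vars_bernoulli_config:
  "prob_space.indep_vars (bernoulli_config \<rho>) (\<lambda>_. measure_pmf (bernoulli_pmf \<rho>)) (\<lambda>i \<eta>. \<eta> i) UNIV"
proof -
  interpret prob_space "bernoulli_config \<rho>" by (rule prob_space_bernoulli_config)
  have "distr (bernoulli_config \<rho>) (\<Pi>\<^sub>M i\<in>UNIV. measure_pmf (bernoulli_pmf \<rho>)) (\<lambda>\<eta>. \<eta>)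
      = bernoulli_config \<rho>"
    unfolding bernoulli_config_def by (rule distr_id)
  then show ?thesis
    by (subst indep_vars_iff_distr_eq_PiM')
      (auto simp: distr_bernoulli_config_component restrict_UNIV intro: measurable_bernoulli_config_component_pmf
        simp flip: bernoulli_config_def)
qed

lemma nn_integral_bernoulli_config_component:
  assumes "0 \<le> \<rho>" "\<rho> \<le> 1"
  shows "(\<integral>\<^sup>+\<eta>. f (\<eta> i) \<partial>bernoulli_config \<rho>) = f True * ennreal \<rho> + f False * ennreal (1 - \<rho>)"
proof -
  have "(\<integral>\<^sup>+\<eta>. f (\<eta> i) \<partial>bernoulli_config \<rho>)
      = (\<integral>\<^sup>+x. f x \<partial>distr (bernoulli_config \<rho>) (measure_pmf (bernoulli_pmf \<rho>)) (\<lambda>\<eta>. \<eta> i))"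
    by (subst nn_integral_distr) (auto intro: measurable_bernoulli_config_component_pmf)
  then show ?thesis
    using assms by (simp add: distr_bernoulli_config_component)
qed

lemma integral_bernoulli_config_component:
  fixes f :: "bool \<Rightarrow> real"
  assumes "0 \<le> \<rho>" "\<rho> \<le> 1"
  shows "(\<integral>\<eta>. f (\<eta> i) \<partial>bernoulli_config \<rho>) = f True * \<rho> + f False * (1 - \<rho>)"
proof -
  have "(\<integral>\<eta>. f (\<eta> i) \<partial>bernoulli_config \<rho>)
      = (\<integral>x. f x \<partial>distr (bernoulli_config \<rho>) (measure_pmf (bernoulli_pmf \<rho>)) (\<lambda>\<eta>. \<eta> i))"
    by (subst integral_distr) (auto intro: measurable_bernoulli_config_component_pmf)
  then show ?thesis
    using assms by (simp add: distr_bernoulli_config_component)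
qed

text \<open>Reindexing a product of identical factors along an injection gives the same
  product.\<close>

lemma distr_bernoulli_config_shift:
  "distr (bernoulli_config \<rho>) (bernoulli_config \<rho>) (\<lambda>\<eta> i. \<eta> (i + c)) = bernoulli_config \<rho>"
  using distr_PiM_reindex[of UNIV "\<lambda>_. measure_pmf (bernoulli_pmf \<rho>)" "\<lambda>i. i + c" UNIV]
  by (simp add: bernoulli_config_def prob_space_measure_pmf inj_on_def restrict_UNIV)

text \<open>By independence the mean of the term of length \<open>m\<close> is the
  \<open>m\<close>-th power of the mean weight of one site, so the sum becomes a geometric
  series.\<close>

lemma nn_integral_excess_weight:
  assumes "0 \<le> \<rho>" "\<rho> \<le> 1" "0 < r"
  shows "(\<integral>\<^sup>+\<eta>. excess_weight r \<eta> a \<partial>bernoulli_config \<rho>)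
    = (\<Sum>m. ennreal ((\<rho> * r + (1 - \<rho>) / r) ^ m))"
proof -
  interpret prob_space "bernoulli_config \<rho>" by (rule prob_space_bernoulli_config)
  define g where "g b = ennreal (if b then r else inverse r)" for b
  have "(\<integral>\<^sup>+\<eta>. (\<Prod>k<m. g (\<eta> (a - int k))) \<partial>bernoulli_config \<rho>)
      = ennreal ((\<rho> * r + (1 - \<rho>) / r) ^ m)" for m
  proof -
    have "indep_vars (\<lambda>_. borel) (\<lambda>i \<eta>. g (\<eta> i)) UNIV"
      using indep_vars_compose2[OF indep_vars_bernoulli_config, of "\<lambda>_. g" "\<lambda>_. borel"] by simp
    then have indep: "indep_vars (\<lambda>_. borel) (\<lambda>i \<eta>. g (\<eta> i)) ((\<lambda>k. a - int k) ` {..<m})"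
      by (rule indep_vars_subset) simp
    have inj: "inj_on (\<lambda>k. a - int k) {..<m}" by (simp add: inj_on_def)
    have "(\<integral>\<^sup>+\<eta>. (\<Prod>k<m. g (\<eta> (a - int k))) \<partial>bernoulli_config \<rho>)
        = (\<integral>\<^sup>+\<eta>. (\<Prod>i\<in>(\<lambda>k. a - int k) ` {..<m}. g (\<eta> i)) \<partial>bernoulli_config \<rho>)"
      using inj by (simp add: prod.reindex)
    also have "\<dots> = (\<Prod>i\<in>(\<lambda>k. a - int k) ` {..<m}. \<integral>\<^sup>+\<eta>. g (\<eta> i) \<partial>bernoulli_config \<rho>)"
      using indep by (intro indep_vars_nn_integral) auto
    also have "\<dots> = (\<Prod>i\<in>(\<lambda>k. a - int k) ` {..<m}. ennreal (\<rho> * r + (1 - \<rho>) / r))"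
      using assms by (intro prod.cong refl, subst nn_integral_bernoulli_config_component)
        (simp_all add: g_def divide_inverse mult.commute flip: ennreal_mult ennreal_plus)
    also have "\<dots> = ennreal ((\<rho> * r + (1 - \<rho>) / r) ^ m)"
      using assms inj by (simp add: card_image ennreal_power del: ennreal_plus)
    finally show ?thesis .
  qed
  moreover have "excess_weight r \<eta> a = (\<Sum>m. \<Prod>k<m. g (\<eta> (a - int k)))" for \<eta>
    unfolding excess_weight_def g_def using assms
    by (intro suminf_cong prod_ennreal[symmetric]) auto
  moreover have "(\<lambda>\<eta>. \<Prod>k<m. g (\<eta> (a - int k))) \<in> borel_measurable (bernoulli_config \<rho>)" for m
    unfolding g_def by measurable
  ultimately show ?thesis
    by (simp add: nn_integral_suminf)
qed

text \<open>The weight \<open>r = 1 / (2 * \<rho>)\<close> lies strictly between the two solutions \<open>1\<close> and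
  \<open>(1 - \<rho>) / \<rho>\<close> of \<open>\<rho> * r + (1 - \<rho>) / r = 1\<close>.\<close>

lemma nn_integral_excess_weight_finite:
  assumes "0 < \<rho>" "\<rho> < 1/2"
  obtains K where "0 \<le> K" "\<And>a. (\<integral>\<^sup>+\<eta>. excess_weight (1 / (2 * \<rho>)) \<eta> a \<partial>bernoulli_config \<rho>) = ennreal K"
proof -
  define q where "q = \<rho> * (1 / (2 * \<rho>)) + (1 - \<rho>) / (1 / (2 * \<rho>))"
  have q: "q = 1 / 2 + 2 * \<rho> * (1 - \<rho>)"
    using assms by (simp add: q_def field_simps)
  \<comment> \<open>This square is twice \<open>1 - q\<close>, so it yields convergence of the
    series.\<close>
  have "0 < (1 - 2 * \<rho>)\<^sup>2" using assms by simp
  then have "q < 1" by (simp add: q power2_eq_square algebra_simps)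
  moreover have "0 \<le> q" using assms by (simp add: q)
  ultimately have "(\<Sum>m. ennreal (q ^ m)) = ennreal (\<Sum>m. q ^ m)" "0 \<le> (\<Sum>m. q ^ m)"
    by (auto intro!: suminf_ennreal2 suminf_nonneg summable_geometric)
  with that[of "\<Sum>m. q ^ m"] show ?thesis
    using assms by (simp add: nn_integral_excess_weight q_def)
qed

section \<open>Mean current and balance of the particle count\<close>

lemma integral_current_shift_invariant:
  "(\<integral>\<eta>. real (current \<eta> t a) \<partial>bernoulli_config \<rho>) = (\<integral>\<eta>. real (current \<eta> t 0) \<partial>bernoulli_config \<rho>)"
proof -
  have meas: "(\<lambda>\<eta> i. \<eta> (i + a)) \<in> bernoulli_config \<rho> \<rightarrow>\<^sub>M bernoulli_config \<rho>"
    by (subst (2) bernoulli_config_def)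
      (intro measurable_PiM_single', auto intro: measurable_bernoulli_config_component_pmf)
  have "(\<integral>\<eta>. real (current \<eta> t 0) \<partial>bernoulli_config \<rho>)
      = (\<integral>\<eta>. real (current \<eta> t 0) \<partial>distr (bernoulli_config \<rho>) (bernoulli_config \<rho>) (\<lambda>\<eta> i. \<eta> (i + a)))"
    by (simp add: distr_bernoulli_config_shift)
  also have "\<dots> = (\<integral>\<eta>. real (current \<eta> t a) \<partial>bernoulli_config \<rho>)"
    using meas by (subst integral_distr) (auto simp: current_shift)
  finally show ?thesis by simp
qed

lemma integrable_current: "integrable (bernoulli_config \<rho>) (\<lambda>\<eta>. real (current \<eta> t a))"
proof -
  interpret prob_space "bernoulli_config \<rho>" by (rule prob_space_bernoulli_config)
  show ?thesis
    by (rule integrable_const_bound[where B = "real t"]) (auto simp: current_le)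
qed

text \<open>Summing \<open>site_balance\<close> over the window cancels all interior currents and
  leaves those through its two boundary bonds.\<close>

lemma count_balance:
  "(\<Sum>i=1..int L. of_bool (ftasep t \<eta> i))
    = (\<Sum>i=1..int L. of_bool (\<eta> i)) + real (current \<eta> t 0) - real (current \<eta> t (int L))"
proof (induction L)
  case (Suc L)
  have *: "{1..int (Suc L)} = insert (int L + 1) {1..int L}" by auto
  have "real_of_int (of_bool (ftasep t \<eta> (int L + 1)))
      = real_of_int (of_bool (\<eta> (int L + 1)) + int (current \<eta> t (int L)) - int (current \<eta> t (int L + 1)))"
    by (subst site_balance) simp
  then have "of_bool (ftasep t \<eta> (int L + 1))
      = of_bool (\<eta> (int L + 1)) + real (current \<eta> t (int L)) - real (current \<eta> t (int L + 1))"
    by simp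
  with Suc show ?case
    unfolding * by (subst (1 2) sum.insert) (auto simp: add.commute)
qed simp

section \<open>Fluctuations of the initial count\<close>

definition initial_fluctuation :: "real \<Rightarrow> nat \<Rightarrow> config \<Rightarrow> real" where
  "initial_fluctuation \<rho> L \<eta> = (\<Sum>i=1..int L. of_bool (\<eta> i) - \<rho>)"

lemma measurable_initial_fluctuation [measurable]:
  "initial_fluctuation \<rho> L \<in> borel_measurable (bernoulli_config \<rho>')"
  unfolding initial_fluctuation_def [abs_def] of_bool_def by measurable

lemma integrable_bernoulli_config_component:
  fixes f :: "bool \<Rightarrow> real"
  shows "integrable (bernoulli_config \<rho>) (\<lambda>\<eta>. f (\<eta> i))"
proof -
  interpret prob_space "bernoulli_config \<rho>" by (rule prob_space_bernoulli_config)
  have "norm (f b) \<le> \<bar>f True\<bar> + \<bar>f False\<bar>" for b by (cases b) auto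
  then show ?thesis
    by (intro integrable_const_bound[where B = "\<bar>f True\<bar> + \<bar>f False\<bar>"]) auto
qed

text \<open>Distinct sites are independent and centred, so only the \<open>L\<close> diagonal terms
  of the expanded square contribute.\<close>

lemma
  assumes "0 \<le> \<rho>" "\<rho> \<le> 1"
  shows integral_initial_fluctuation: "(\<integral>\<eta>. initial_fluctuation \<rho> L \<eta> \<partial>bernoulli_config \<rho>) = 0"
    and integrable_initial_fluctuation_square:
      "integrable (bernoulli_config \<rho>) (\<lambda>\<eta>. (initial_fluctuation \<rho> L \<eta>)\<^sup>2)"
    and integral_initial_fluctuation_square:
      "(\<integral>\<eta>. (initial_fluctuation \<rho> L \<eta>)\<^sup>2 \<partial>bernoulli_config \<rho>) = real L * (\<rho> * (1 - \<rho>))"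
proof -
  interpret prob_space "bernoulli_config \<rho>" by (rule prob_space_bernoulli_config)
  define g where "g b = of_bool b - \<rho>" for b
  have int_g: "(\<integral>\<eta>. g (\<eta> i) \<partial>bernoulli_config \<rho>) = 0" for i
    using assms by (subst integral_bernoulli_config_component) (auto simp: g_def algebra_simps)
  have fluct: "initial_fluctuation \<rho> L \<eta> = (\<Sum>i=1..int L. g (\<eta> i))" for \<eta>
    by (simp add: initial_fluctuation_def g_def)
  show "(\<integral>\<eta>. initial_fluctuation \<rho> L \<eta> \<partial>bernoulli_config \<rho>) = 0"
    by (simp add: fluct int_g integrable_bernoulli_config_component)
  have cov: "integrable (bernoulli_config \<rho>) (\<lambda>\<eta>. g (\<eta> i) * g (\<eta> j)) \<and>
      (\<integral>\<eta>. g (\<eta> i) * g (\<eta> j) \<partial>bernoulli_config \<rho>) = (if j = i then \<rho> * (1 - \<rho>) else 0)" for i j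
  proof (cases "i = j")
    case True
    have "integrable (bernoulli_config \<rho>) (\<lambda>\<eta>. (\<lambda>b. g b * g b) (\<eta> i))"
      by (rule integrable_bernoulli_config_component)
    moreover have "(\<integral>\<eta>. (\<lambda>b. g b * g b) (\<eta> i) \<partial>bernoulli_config \<rho>) = \<rho> * (1 - \<rho>)"
      using assms by (subst integral_bernoulli_config_component) (auto simp: g_def algebra_simps)
    ultimately show ?thesis using True by simp
  next
    case False
    have "indep_vars (\<lambda>_. borel) (\<lambda>i \<eta>. g (\<eta> i)) UNIV"
      using indep_vars_compose2[OF indep_vars_bernoulli_config, of "\<lambda>_. g" "\<lambda>_. borel"] by simp
    then have indep: "indep_vars (\<lambda>_. borel) (\<lambda>i \<eta>. g (\<eta> i)) {i, j}"
      by (rule indep_vars_subset) simp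
    have "integrable (bernoulli_config \<rho>) (\<lambda>\<eta>. \<Prod>k\<in>{i, j}. g (\<eta> k))"
      using indep by (intro indep_vars_integrable integrable_bernoulli_config_component) auto
    moreover have "(\<integral>\<eta>. (\<Prod>k\<in>{i, j}. g (\<eta> k)) \<partial>bernoulli_config \<rho>)
        = (\<Prod>k\<in>{i, j}. \<integral>\<eta>. g (\<eta> k) \<partial>bernoulli_config \<rho>)"
      using indep by (intro indep_vars_lebesgue_integral integrable_bernoulli_config_component) auto
    ultimately show ?thesis using False by (simp add: int_g)
  qed
  have sq: "(initial_fluctuation \<rho> L \<eta>)\<^sup>2 = (\<Sum>i=1..int L. \<Sum>j=1..int L. g (\<eta> i) * g (\<eta> j))" for \<eta>
    by (simp add: fluct power2_eq_square sum_product)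
  show "integrable (bernoulli_config \<rho>) (\<lambda>\<eta>. (initial_fluctuation \<rho> L \<eta>)\<^sup>2)"
    unfolding sq using cov by (intro Bochner_Integration.integrable_sum) blast
  show "(\<integral>\<eta>. (initial_fluctuation \<rho> L \<eta>)\<^sup>2 \<partial>bernoulli_config \<rho>) = real L * (\<rho> * (1 - \<rho>))"
    unfolding sq using cov
    by (simp add: Bochner_Integration.integral_sum Bochner_Integration.integrable_sum sum.delta)
qed

section \<open>Almost sure convergence and the asymptotic variance\<close>

theorem theorem3p8:
  fixes \<rho> :: real
  assumes "0 < \<rho>" and "\<rho> < 1/2"
  shows "(AE \<eta> in bernoulli_config \<rho>. \<forall>i. (\<lambda>t. ftasep t \<eta> i) \<longlonglongrightarrow> ftasep_lim \<eta> i)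
    \<and> (\<forall>L. integrable (bernoulli_config \<rho>) (\<lambda>\<eta>. (limit_count L \<eta>)\<^sup>2)
          \<and> limit_count_var \<rho> L = (\<integral>\<eta>. (limit_count L \<eta>)\<^sup>2 \<partial>bernoulli_config \<rho>) - (\<rho> * real L)\<^sup>2)
    \<and> (\<lambda>L. limit_count_var \<rho> L / real L) \<longlonglongrightarrow> \<rho> * (1 - \<rho>)"
proof -
  interpret prob_space "bernoulli_config \<rho>" by (rule prob_space_bernoulli_config)
  let ?\<mu> = "bernoulli_config \<rho>"
  define r where "r = 1 / (2 * \<rho>)"
  \<comment> \<open>An integrable bound for the squared current at \<open>a\<close>, uniform in
    time. Since \<open>enn2real\<close> sends an infinite weight to \<open>0\<close>, the bound is
    claimed only almost everywhere, where all weights are finite.\<close>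
  define w where "w a \<eta> = r / (r - 1)\<^sup>2 * enn2real (excess_weight r \<eta> a)" for a \<eta>
  \<comment> \<open>The boundary term: by \<open>count_balance\<close> it is almost surely the limit
    of the difference of the currents at \<open>0\<close> and \<open>L\<close>.\<close>
  define \<Delta> where "\<Delta> L \<eta> = limit_count L \<eta> - (\<Sum>i=1..int L. of_bool (\<eta> i))" for L \<eta>
  define A where "A = initial_fluctuation \<rho>"
  have r: "r > 1" using assms by (simp add: r_def)
  obtain K0 where K0: "0 \<le> K0" "\<And>a. (\<integral>\<^sup>+\<eta>. excess_weight r \<eta> a \<partial>?\<mu>) = ennreal K0"
    using nn_integral_excess_weight_finite[OF assms] unfolding r_def by metis
  \<comment> \<open>Each \<open>w a\<close> has mean \<open>K / 4\<close>. As the square of a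
    difference is at most twice the sum of the squares, \<open>K\<close> bounds the second moment of
    \<open>\<Delta> L\<close> for every \<open>L\<close>.\<close>
  define K where "K = 4 * (r / (r - 1)\<^sup>2 * K0)"
  have "AE \<eta> in ?\<mu>. \<forall>a. excess_weight r \<eta> a \<noteq> \<infinity>"
    unfolding AE_all_countable by (intro allI nn_integral_PInf_AE) (auto simp: K0)
  then have current_bound: "AE \<eta> in ?\<mu>. \<forall>a t. (real (current \<eta> t a))\<^sup>2 \<le> w a \<eta>"
  proof eventually_elim
    case (elim \<eta>)
    show ?case
    proof (intro allI)
      fix a t
      have "ennreal ((real (current \<eta> t a))\<^sup>2) \<le> ennreal (r / (r - 1)\<^sup>2) * excess_weight r \<eta> a"
        using r by (rule current_square_le_excess_weight)
      also have "excess_weight r \<eta> a = ennreal (enn2real (excess_weight r \<eta> a))"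
        using elim by (simp add: less_top)
      also have "ennreal (r / (r - 1)\<^sup>2) * \<dots> = ennreal (w a \<eta>)"
        unfolding w_def using r by (intro ennreal_mult[symmetric]) auto
      finally show "(real (current \<eta> t a))\<^sup>2 \<le> w a \<eta>"
        using r by (subst (asm) ennreal_le_iff) (auto simp: w_def)
    qed
  qed
  have w_meas [measurable]: "w a \<in> borel_measurable ?\<mu>" for a
    unfolding w_def by measurable
  have "integrable ?\<mu> (\<lambda>\<eta>. enn2real (excess_weight r \<eta> a)) \<and>
      (\<integral>\<eta>. enn2real (excess_weight r \<eta> a) \<partial>?\<mu>) = K0" for a
  proof -
    have "AE \<eta> in ?\<mu>. excess_weight r \<eta> a \<noteq> \<infinity>"
      by (intro nn_integral_PInf_AE) (auto simp: K0)
    then have "(\<integral>\<^sup>+\<eta>. ennreal (enn2real (excess_weight r \<eta> a)) \<partial>?\<mu>) = (\<integral>\<^sup>+\<eta>. excess_weight r \<eta> a \<partial>?\<mu>)"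
      by (intro nn_integral_cong_AE) (auto simp: less_top)
    then show ?thesis
      using K0 by (subst (asm) (1) K0(2), subst (asm) nn_integral_eq_integrable) auto
  qed
  then have w_int: "integrable ?\<mu> (w a)" "(\<integral>\<eta>. w a \<eta> \<partial>?\<mu>) = K / 4" for a
    unfolding w_def K_def by simp_all
  have conv: "AE \<eta> in ?\<mu>. \<forall>i. (\<lambda>t. ftasep t \<eta> i) \<longlonglongrightarrow> ftasep_lim \<eta> i"
    using current_bound
  proof eventually_elim
    case (elim \<eta>)
    have "bdd_above (range (\<lambda>t. current \<eta> t i))" for i
    proof (rule bdd_aboveI2)
      fix t
      have "(real (current \<eta> t i))\<^sup>2 \<le> w i \<eta>" using elim by blast
      moreover have "real (current \<eta> t i) \<le> (real (current \<eta> t i))\<^sup>2"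
        by (simp add: power2_eq_square flip: of_nat_mult)
      ultimately show "current \<eta> t i \<le> nat \<lceil>w i \<eta>\<rceil>" by linarith
    qed
    then show ?case using ftasep_convergent_if_current_bounded by blast
  qed
  have \<Delta>_lim: "AE \<eta> in ?\<mu>. (\<lambda>t. real (current \<eta> t 0) - real (current \<eta> t (int L))) \<longlonglongrightarrow> \<Delta> L \<eta>" for L
    using conv
  proof eventually_elim
    case (elim \<eta>)
    have "(\<lambda>t. of_bool (ftasep t \<eta> i) :: real) \<longlonglongrightarrow> of_bool (ftasep_lim \<eta> i)" for i
      using elim[rule_format, of i] unfolding tendsto_discrete
      by (intro tendsto_eventually) (auto elim: eventually_mono)
    then have "(\<lambda>t. (\<Sum>i=1..int L. of_bool (ftasep t \<eta> i)) - (\<Sum>i=1..int L. of_bool (\<eta> i)))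
        \<longlonglongrightarrow> \<Delta> L \<eta>"
      unfolding \<Delta>_def limit_count_def by (intro tendsto_intros)
    then show ?case by (simp add: count_balance)
  qed
  have \<Delta>_meas [measurable]: "\<Delta> L \<in> borel_measurable ?\<mu>" for L
    unfolding \<Delta>_def [abs_def] of_bool_def by measurable
  have \<Delta>_sq_le: "AE \<eta> in ?\<mu>. (\<Delta> L \<eta>)\<^sup>2 \<le> 2 * w 0 \<eta> + 2 * w (int L) \<eta>" for L
    using \<Delta>_lim[of L] current_bound
  proof eventually_elim
    case (elim \<eta>)
    have "(real (current \<eta> t 0) - real (current \<eta> t (int L)))\<^sup>2 \<le> 2 * w 0 \<eta> + 2 * w (int L) \<eta>" for t
    proof -
      have "(x - y)\<^sup>2 \<le> 2 * x\<^sup>2 + 2 * y\<^sup>2" for x y :: real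
        using zero_le_power2[of "x + y"] by (simp add: power2_eq_square algebra_simps)
      then have "(real (current \<eta> t 0) - real (current \<eta> t (int L)))\<^sup>2
          \<le> 2 * (real (current \<eta> t 0))\<^sup>2 + 2 * (real (current \<eta> t (int L)))\<^sup>2" .
      also have "\<dots> \<le> 2 * w 0 \<eta> + 2 * w (int L) \<eta>"
        using elim(2) by (intro add_mono mult_left_mono) auto
      finally show ?thesis .
    qed
    then show ?case
      using tendsto_power[OF elim(1), of 2] by (intro LIMSEQ_le_const2) auto
  qed
  have \<Delta>_sq_int: "integrable ?\<mu> (\<lambda>\<eta>. (\<Delta> L \<eta>)\<^sup>2)" for L
    by (rule Bochner_Integration.integrable_bound[where f = "\<lambda>\<eta>. 2 * w 0 \<eta> + 2 * w (int L) \<eta>"])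
      (use w_int \<Delta>_sq_le[of L] in auto)
  have \<Delta>_sq: "(\<integral>\<eta>. (\<Delta> L \<eta>)\<^sup>2 \<partial>?\<mu>) \<le> K" for L
  proof -
    have "(\<integral>\<eta>. (\<Delta> L \<eta>)\<^sup>2 \<partial>?\<mu>) \<le> (\<integral>\<eta>. 2 * w 0 \<eta> + 2 * w (int L) \<eta> \<partial>?\<mu>)"
      using \<Delta>_sq_int \<Delta>_sq_le w_int by (intro integral_mono_AE) auto
    also have "\<dots> = K" using w_int(1) by (simp add: w_int(2))
    finally show ?thesis .
  qed
  have \<Delta>_mean: "(\<integral>\<eta>. \<Delta> L \<eta> \<partial>?\<mu>) = 0" for L
  proof -
    \<comment> \<open>The difference of the currents equals a difference of two counts on
      \<open>L\<close> sites. This gives a constant dominating function, so the mean of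
      \<open>\<Delta> L\<close> is the limit of the means at finite times, which vanish by shift
      invariance.\<close>
    have "\<bar>real (current \<eta> t 0) - real (current \<eta> t (int L))\<bar> \<le> real L" for t \<eta>
    proof -
      have "0 \<le> (\<Sum>i=1..int L. of_bool (\<zeta> i) :: real) \<and> (\<Sum>i=1..int L. of_bool (\<zeta> i)) \<le> real L"
        for \<zeta> :: config
        using sum_mono[of "{1..int L}" "\<lambda>i. of_bool (\<zeta> i) :: real" "\<lambda>_. 1"]
          sum_nonneg[of "{1..int L}" "\<lambda>i. of_bool (\<zeta> i) :: real"]
        by auto
      from this[of \<eta>] this[of "ftasep t \<eta>"] show ?thesis
        using count_balance[of t \<eta> L] by linarith
    qed
    then have "(\<lambda>t. \<integral>\<eta>. real (current \<eta> t 0) - real (current \<eta> t (int L)) \<partial>?\<mu>) \<longlonglongrightarrow> (\<integral>\<eta>. \<Delta> L \<eta> \<partial>?\<mu>)"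
      using \<Delta>_lim[of L] by (intro integral_dominated_convergence[where w = "\<lambda>_. real L"]) auto
    moreover have "(\<integral>\<eta>. real (current \<eta> t 0) - real (current \<eta> t (int L)) \<partial>?\<mu>) = 0" for t
      using integral_current_shift_invariant[where t = t and a = "int L" and \<rho> = \<rho>]
      by (simp add: integrable_current)
    ultimately show ?thesis by (simp add: LIMSEQ_const_iff)
  qed
  have count_eq: "limit_count L \<eta> = \<rho> * real L + A L \<eta> + \<Delta> L \<eta>" for L \<eta>
    by (simp add: \<Delta>_def A_def initial_fluctuation_def sum_subtractf)
  have A_mean: "(\<integral>\<eta>. A L \<eta> \<partial>?\<mu>) = 0" and A_sq_int: "integrable ?\<mu> (\<lambda>\<eta>. (A L \<eta>)\<^sup>2)"
    and A_sq: "(\<integral>\<eta>. (A L \<eta>)\<^sup>2 \<partial>?\<mu>) = real L * (\<rho> * (1 - \<rho>))" for L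
    unfolding A_def using assms
    by (auto intro: integral_initial_fluctuation integrable_initial_fluctuation_square
        integral_initial_fluctuation_square)
  have A_meas [measurable]: "A L \<in> borel_measurable ?\<mu>" for L
    unfolding A_def by measurable
  have A_int: "integrable ?\<mu> (A L)" for L
    by (rule square_integrable_imp_integrable) (auto simp: A_sq_int)
  have \<Delta>_int: "integrable ?\<mu> (\<Delta> L)" for L
    by (rule square_integrable_imp_integrable) (auto simp: \<Delta>_sq_int)
  have count_sq_int: "integrable ?\<mu> (\<lambda>\<eta>. (limit_count L \<eta>)\<^sup>2)" for L
    by (rule integrable_const_bound[where B = "(real L)\<^sup>2"])
      (auto intro: power_mono limit_count_bounds)
  have count_int: "integrable ?\<mu> (limit_count L)" for L
    by (rule square_integrable_imp_integrable) (auto simp: count_sq_int)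
  have count_mean: "(\<integral>\<eta>. limit_count L \<eta> \<partial>?\<mu>) = \<rho> * real L" for L
    unfolding count_eq using A_int \<Delta>_int prob_space by (simp add: A_mean \<Delta>_mean)
  have var1: "limit_count_var \<rho> L = (\<integral>\<eta>. (limit_count L \<eta>)\<^sup>2 \<partial>?\<mu>) - (\<rho> * real L)\<^sup>2" for L
    unfolding limit_count_var_def using count_int count_sq_int
    by (subst variance_eq) (auto simp: count_mean)
  have var2: "limit_count_var \<rho> L = (\<integral>\<eta>. (A L \<eta> + \<Delta> L \<eta>)\<^sup>2 \<partial>?\<mu>)" for L
    unfolding limit_count_var_def count_mean by (simp add: count_eq)
  have bound: "\<bar>limit_count_var \<rho> L / real L - \<rho> * (1 - \<rho>)\<bar> \<le> (\<rho> * (1 - \<rho>) + 2 * K) / sqrt (real L)"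
    if "L \<ge> 1" for L
  proof -
    \<comment> \<open>The cross term is split by a weighted Young inequality. The second moment of
      \<open>A L\<close> has order \<open>s\<^sup>2\<close> and that of \<open>\<Delta> L\<close> is
      bounded, so with this weight both parts have order at most \<open>s\<close>, negligible
      against \<open>L = s * s\<close>.\<close>
    define s where "s = sqrt (real L)"
    have s: "s \<ge> 1" "real L = s * s" using that by (auto simp: s_def)
    have pointwise: "\<bar>(A L \<eta> + \<Delta> L \<eta>)\<^sup>2 - (A L \<eta>)\<^sup>2\<bar> \<le> (A L \<eta>)\<^sup>2 / s + (s + 1) * (\<Delta> L \<eta>)\<^sup>2" for \<eta>
    proof -
      have "2 * \<bar>x * y\<bar> \<le> x\<^sup>2 / s + s * y\<^sup>2" for x y :: real
      proof -
        have "0 \<le> (\<bar>x\<bar> - s * \<bar>y\<bar>)\<^sup>2 / s" using s by simp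
        also have "\<dots> = x\<^sup>2 / s + s * y\<^sup>2 - 2 * \<bar>x * y\<bar>"
          using s by (simp add: power2_diff power_mult_distrib abs_mult field_simps power2_eq_square)
        finally show ?thesis by simp
      qed
      from this[of "A L \<eta>" "\<Delta> L \<eta>"]
      have "2 * \<bar>A L \<eta> * \<Delta> L \<eta>\<bar> \<le> (A L \<eta>)\<^sup>2 / s + s * (\<Delta> L \<eta>)\<^sup>2" .
      moreover have "(A L \<eta> + \<Delta> L \<eta>)\<^sup>2 - (A L \<eta>)\<^sup>2 = 2 * (A L \<eta> * \<Delta> L \<eta>) + (\<Delta> L \<eta>)\<^sup>2"
        by (simp add: power2_sum)
      moreover have "(s + 1) * (\<Delta> L \<eta>)\<^sup>2 = s * (\<Delta> L \<eta>)\<^sup>2 + (\<Delta> L \<eta>)\<^sup>2"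
        by (simp add: distrib_right)
      moreover have "0 \<le> (\<Delta> L \<eta>)\<^sup>2" by simp
      ultimately show ?thesis by linarith
    qed
    have sum_sq_int: "integrable ?\<mu> (\<lambda>\<eta>. (A L \<eta> + \<Delta> L \<eta>)\<^sup>2)"
    proof -
      have "integrable ?\<mu> (\<lambda>\<eta>. (limit_count L \<eta>)\<^sup>2 - 2 * (\<rho> * real L) * limit_count L \<eta> + (\<rho> * real L)\<^sup>2)"
        using count_sq_int count_int by simp
      moreover have "(A L \<eta> + \<Delta> L \<eta>)\<^sup>2
          = (limit_count L \<eta>)\<^sup>2 - 2 * (\<rho> * real L) * limit_count L \<eta> + (\<rho> * real L)\<^sup>2" for \<eta>
        unfolding count_eq by (simp add: power2_eq_square algebra_simps)
      ultimately show ?thesis by simp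
    qed
    have "\<bar>limit_count_var \<rho> L - real L * (\<rho> * (1 - \<rho>))\<bar>
        = \<bar>\<integral>\<eta>. (A L \<eta> + \<Delta> L \<eta>)\<^sup>2 - (A L \<eta>)\<^sup>2 \<partial>?\<mu>\<bar>"
      using sum_sq_int A_sq_int by (simp add: var2 A_sq)
    also have "\<dots> \<le> (\<integral>\<eta>. (A L \<eta>)\<^sup>2 / s + (s + 1) * (\<Delta> L \<eta>)\<^sup>2 \<partial>?\<mu>)"
      by (intro order_trans[OF integral_abs_bound] integral_mono)
        (use pointwise sum_sq_int A_sq_int \<Delta>_sq_int in auto)
    also have "\<dots> = s * (\<rho> * (1 - \<rho>)) + (s + 1) * (\<integral>\<eta>. (\<Delta> L \<eta>)\<^sup>2 \<partial>?\<mu>)"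
      using A_sq_int \<Delta>_sq_int s by (simp add: A_sq)
    \<comment> \<open>Uses \<open>s + 1 \<le> s + s\<close>, valid because
      \<open>L \<ge> 1\<close>.\<close>
    also have "\<dots> \<le> s * (\<rho> * (1 - \<rho>)) + (s + s) * K"
      using \<Delta>_sq s by (intro add_left_mono mult_mono) auto
    also have "\<dots> = s * (\<rho> * (1 - \<rho>) + 2 * K)" by (simp add: algebra_simps)
    finally have le: "\<bar>limit_count_var \<rho> L - real L * (\<rho> * (1 - \<rho>))\<bar> \<le> s * (\<rho> * (1 - \<rho>) + 2 * K)" .
    have "limit_count_var \<rho> L / real L - \<rho> * (1 - \<rho>) = (limit_count_var \<rho> L - real L * (\<rho> * (1 - \<rho>))) / real L"
      using that by (simp add: diff_divide_distrib)
    then have "\<bar>limit_count_var \<rho> L / real L - \<rho> * (1 - \<rho>)\<bar>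
        = \<bar>limit_count_var \<rho> L - real L * (\<rho> * (1 - \<rho>))\<bar> / real L"
      by (simp add: abs_divide)
    also have "\<dots> \<le> s * (\<rho> * (1 - \<rho>) + 2 * K) / real L"
      using le by (intro divide_right_mono) auto
    also have "\<dots> = (\<rho> * (1 - \<rho>) + 2 * K) / s"
      using s by simp
    finally show ?thesis by (simp add: s_def)
  qed
  have "(\<lambda>L. (\<rho> * (1 - \<rho>) + 2 * K) / sqrt (real L)) \<longlonglongrightarrow> 0"
    by (intro tendsto_divide_0[OF tendsto_const] filterlim_at_top_imp_at_infinity
        filterlim_compose[OF sqrt_at_top] filterlim_real_sequentially)
  then have "(\<lambda>L. limit_count_var \<rho> L / real L - \<rho> * (1 - \<rho>)) \<longlonglongrightarrow> 0"
    by (rule Lim_null_comparison[rotated])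
      (use bound in \<open>auto simp: eventually_sequentially intro!: exI[of _ 1]\<close>)
  then have "(\<lambda>L. limit_count_var \<rho> L / real L) \<longlonglongrightarrow> \<rho> * (1 - \<rho>)"
    by (simp add: LIM_zero_iff)
  with conv count_sq_int var1 show ?thesis by blast
qed

end
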